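(* Let $(U^j)_{j\ge 0}$ be a positive solution (all entries $u_i^j>0$) of the explicit scheme and assume that the time steps verify $$\tau_j < \frac{2}{p(w^{j+1})^{p-1} + \eta}\qquad\text{for every } j\ge 0 .$$ If there exists $j_0$ such that $\Phi_{h}(U^{j_0})<0$, then $(U^j)_{j\ge0}$ blows up.
   Context: Let $N\ge 1$ be an integer and $p>1$ a real number. $M=\mathrm{diag}(m_1,\dots,m_N)$ is a diagonal matrix with $m_k>0$ for all $k$. $A=(a_{ik})$ is a real symmetric positive semidefinite $N\times N$ matrix with $a_{ik}\le 0$ for $i\neq k$, $a_{ii}>0$, and $\sum_{k=1}^N a_{ik}\ge 0$ for every $i$. All operations between vectors of $\mathbb{R}^N$ (in particular powers) are understood coordinate by coordinate, and $\langle\cdot,\cdot\rangle$ is the Euclidean inner product. $\eta$ denotes the greatest eigenvalue of the generalized eigenvalue problem $A\phi=\mu M\phi$. Explicit scheme: fix $\lambda>0$ and an initial vector $U^0\in\mathbb{R}^N$. For $j\ge 0$ write $U^j=(u_1^j,\dots,u_N^j)$, $w^j=\sum_{k=1}^N m_k u_k^j$, $\tau_j=\lambda/(w^j)^p$, and $$M U^{j+1}= M U^j + \tau_j \left (- AU^j + M (U^j)^p\right ).$$ Standing assumption: $\lambda < \min_{1\le i \le N}\frac{m_i}{a_{ii}}(w^0)^p$. The discrete energy is $$\Phi_h(U)=\frac12\langle AU,U\rangle-\frac{1}{p+1}\langle MU^{p+1},E\rangle,\qquad E=(1,1,\dots,1).$$ A solution blows up if $\lim_{j\to\infty}\|U^j\|_\infty=\infty$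 and $\sum_{j=0}^\infty \tau_j<\infty$. *)

theory Defs
  imports "HOL-Analysis.Analysis"
begin

definition diag_matrix :: "real ^ 'n \<Rightarrow> real ^ 'n ^ 'n" where
  "diag_matrix m = (\<chi> i j. if i = j then m $ i else 0)"

definition pos_semidefinite :: "real ^ 'n ^ 'n \<Rightarrow> bool" where
  "pos_semidefinite A \<longleftrightarrow> (\<forall>x. 0 \<le> (A *v x) \<bullet> x)"

text \<open>Coordinatewise power with a real exponent. Below it is only relevant for vectors with
  positive entries, where \<^const>\<open>powr\<close> is the usual real power.\<close>

definition vec_powr :: "real ^ 'n \<Rightarrow> real \<Rightarrow> real ^ 'n" where
  "vec_powr u p = (\<chi> i. (u $ i) powr p)"

definition gen_eigenvalue :: "real ^ 'n ^ 'n \<Rightarrow> real ^ 'n ^ 'n \<Rightarrow> real \<Rightarrow> bool" where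
  "gen_eigenvalue A M \<mu> \<longleftrightarrow> (\<exists>\<phi>. \<phi> \<noteq> 0 \<and> A *v \<phi> = \<mu> *\<^sub>R (M *v \<phi>))"

text \<open>For \<open>A\<close> symmetric and \<open>M\<close> diagonal with positive entries, all eigenvalues of
  \<open>A \<phi> = \<mu> M \<phi>\<close> are real, so only real \<open>\<mu>\<close> need be considered, and a greatest one exists.\<close>

definition max_gen_eigenvalue :: "real ^ 'n ^ 'n \<Rightarrow> real ^ 'n ^ 'n \<Rightarrow> real" where
  "max_gen_eigenvalue A M = (GREATEST \<mu>. gen_eigenvalue A M \<mu>)"

definition mass :: "real ^ 'n \<Rightarrow> real ^ 'n \<Rightarrow> real" where
  "mass m u = (\<Sum>k\<in>UNIV. m $ k * u $ k)"

definition time_step :: "real ^ 'n \<Rightarrow> real \<Rightarrow> real \<Rightarrow> (nat \<Rightarrow> real ^ 'n) \<Rightarrow> nat \<Rightarrow> real" where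
  "time_step m p lam U j = lam / (mass m (U j)) powr p"

definition explicit_scheme ::
  "real ^ 'n ^ 'n \<Rightarrow> real ^ 'n \<Rightarrow> real \<Rightarrow> real \<Rightarrow> (nat \<Rightarrow> real ^ 'n) \<Rightarrow> bool" where
  "explicit_scheme A m p lam U \<longleftrightarrow>
     (\<forall>j. diag_matrix m *v U (Suc j) =
          diag_matrix m *v U j +
          time_step m p lam U j *\<^sub>R (- (A *v U j) + diag_matrix m *v vec_powr (U j) p))"

definition discrete_energy ::
  "real ^ 'n ^ 'n \<Rightarrow> real ^ 'n \<Rightarrow> real \<Rightarrow> real ^ 'n \<Rightarrow> real" where
  "discrete_energy A m p u =
     1 / 2 * ((A *v u) \<bullet> u)
     - 1 / (p + 1) * ((diag_matrix m *v vec_powr u (p + 1)) \<bullet> (\<chi> i. 1))"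

definition blows_up :: "(nat \<Rightarrow> real) \<Rightarrow> (nat \<Rightarrow> real ^ 'n) \<Rightarrow> bool" where
  "blows_up \<tau> U \<longleftrightarrow> filterlim (\<lambda>j. infnorm (U j)) at_top sequentially \<and> summable \<tau>"

end

theory Submission
  imports Defs
begin

text \<open>
  Two estimates carry the proof: the energy never increases, and while it is negative the norm
  \<open>\<parallel>u\<parallel>\<^sub>M = \<langle>M u, u\<rangle>\<^sup>1\<^sup>/\<^sup>2\<close> grows by at least a fixed amount in every step.

  The energy. With \<open>u = U\<^sup>j\<close>, \<open>v = U\<^sup>j\<^sup>+\<^sup>1\<close> and \<open>d = v - u\<close>, the quadratic part of the energy changes by
  \<open>\<langle>Au, d\<rangle> + \<langle>Ad, d\<rangle> / 2\<close>, while convexity of \<open>s \<mapsto> s\<^sup>p\<^sup>+\<^sup>1\<close> bounds the change of the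
  other part from above by \<open>- \<langle>Mu\<^sup>p, d\<rangle>\<close>. The scheme says \<open>Mu\<^sup>p - Au = Md / \<tau>\<close>, so the energy
  changes by at most \<open>\<langle>Ad, d\<rangle> / 2 - \<langle>Md, d\<rangle> / \<tau>\<close>. The Rayleigh bound \<open>\<langle>Ad, d\<rangle> \<le> \<eta> \<langle>Md, d\<rangle>\<close>
  makes this nonpositive as soon as \<open>\<tau> \<le> 2 / \<eta>\<close>, which the restriction on the time steps implies
  (lemma \<open>energy_nonincreasing\<close>).

  The growth. Testing the scheme against \<open>u\<close> gives \<open>\<langle>Md, u\<rangle> = \<tau> (\<langle>Mu\<^sup>p\<^sup>+\<^sup>1, E\<rangle> - \<langle>Au, u\<rangle>)\<close>, and a
  negative energy bounds this below by a multiple of \<open>\<tau> \<langle>Mu\<^sup>p\<^sup>+\<^sup>1, E\<rangle>\<close>. All norms of \<open>u\<close> are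
  comparable, so this is at least a multiple of \<open>\<tau> w\<^sup>p \<parallel>u\<parallel>\<^sub>M = \<lambda> \<parallel>u\<parallel>\<^sub>M\<close>: the choice of the time
  step exactly cancels the superlinear factor. As \<open>\<langle>Mv, u\<rangle> \<le> \<parallel>v\<parallel>\<^sub>M \<parallel>u\<parallel>\<^sub>M\<close> by Cauchy-Schwarz,
  dividing by \<open>\<parallel>u\<parallel>\<^sub>M\<close> yields \<open>\<parallel>v\<parallel>\<^sub>M \<ge> \<parallel>u\<parallel>\<^sub>M + K\<close> with \<open>K > 0\<close> independent of \<open>j\<close>
  (lemma \<open>mass_norm_step\<close>).

  Hence the mass grows at least linearly in \<open>j\<close>. So does the maximum norm, and
  \<open>\<tau>\<^sub>j = \<lambda> / (w\<^sup>j)\<^sup>p\<close> is bounded by a multiple of \<open>j\<^sup>-\<^sup>p\<close>, which is summable because \<open>p > 1\<close>.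
\<close>

section \<open>The inner product and the norm given by the masses\<close>

lemma diag_matrix_mult_nth [simp]:
  "(diag_matrix m *v x) $ i = m $ i * x $ i"
  by (simp add: diag_matrix_def matrix_vector_mult_def if_distrib[of "\<lambda>c. c * _"] cong: if_cong)

lemma inner_diag_matrix:
  "(diag_matrix m *v x) \<bullet> y = (\<Sum>k\<in>UNIV. m $ k * x $ k * y $ k)"
  by (simp add: inner_vec_def)

text \<open>Scaling by the square roots of the masses turns the inner product \<open>\<langle>Mx, y\<rangle>\<close> into the
  Euclidean one, so Cauchy-Schwarz for \<open>\<langle>Mx, y\<rangle>\<close> is that of the ambient space.\<close>

definition mass_norm :: "real ^ 'n \<Rightarrow> real ^ 'n \<Rightarrow> real" where
  "mass_norm m x = norm (\<chi> k. sqrt (m $ k) * x $ k)"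

lemma inner_diag_matrix_scaled:
  assumes "\<And>k. m $ k > 0"
  shows "(diag_matrix m *v x) \<bullet> y
           = (\<chi> k. sqrt (m $ k) * x $ k) \<bullet> (\<chi> k. sqrt (m $ k) * y $ k)"
proof -
  have scaled: "sqrt (m $ k) * x $ k * (sqrt (m $ k) * y $ k) = m $ k * x $ k * y $ k" for k
    using assms[of k]
    by (metis (no_types, opaque_lifting) abs_of_pos mult.assoc mult.left_commute real_sqrt_mult_self)
  show ?thesis
    unfolding inner_diag_matrix
    unfolding inner_vec_def inner_real_def vec_lambda_beta by (simp only: scaled)
qed

lemma mass_norm_square:
  assumes "\<And>k. m $ k > 0"
  shows "(mass_norm m x)\<^sup>2 = (\<Sum>k\<in>UNIV. m $ k * (x $ k)\<^sup>2)"
proof -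
  have "(mass_norm m x)\<^sup>2 = (diag_matrix m *v x) \<bullet> x"
    unfolding inner_diag_matrix_scaled[OF assms] mass_norm_def by (simp add: dot_square_norm)
  then show ?thesis
    by (simp add: inner_diag_matrix power2_eq_square mult.assoc)
qed

lemma mass_norm_Cauchy_Schwarz:
  assumes "\<And>k. m $ k > 0"
  shows "(diag_matrix m *v x) \<bullet> y \<le> mass_norm m x * mass_norm m y"
  unfolding inner_diag_matrix_scaled[OF assms] mass_norm_def by (rule norm_cauchy_schwarz)

lemma inner_diag_matrix_nonneg:
  assumes "\<And>k. m $ k > 0"
  shows "(diag_matrix m *v x) \<bullet> x \<ge> 0"
  unfolding inner_diag_matrix_scaled[OF assms] by simp

lemma inner_diag_matrix_pos:
  assumes "\<And>k. m $ k > 0" and "x \<noteq> 0"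
  shows "(diag_matrix m *v x) \<bullet> x > 0"
proof -
  obtain i where "x $ i \<noteq> 0"
    using assms(2) by (auto simp: vec_eq_iff)
  then have "0 < m $ i * (x $ i)\<^sup>2"
    using assms(1) by simp
  also have "\<dots> \<le> (\<Sum>k\<in>UNIV. m $ k * (x $ k)\<^sup>2)"
    by (rule member_le_sum) (auto intro!: mult_nonneg_nonneg less_imp_le[OF assms(1)])
  finally show ?thesis
    by (simp add: inner_diag_matrix power2_eq_square mult.assoc)
qed

section \<open>The Rayleigh bound for the greatest generalized eigenvalue\<close>

lemma inner_matrix_symmetric:
  fixes A :: "real ^ 'n ^ 'n"
  assumes "transpose A = A"
  shows "(A *v x) \<bullet> y = (A *v y) \<bullet> x"
  using assms by (metis dot_lmul_matrix inner_commute transpose_matrix_vector)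

text \<open>Where a nonnegative quadratic form vanishes it has a minimum, so its gradient vanishes there
  too. Explicitly, at \<open>x - t B x\<close> the form is
  \<open>- 2 t \<parallel>B x\<parallel>\<^sup>2 + O(t\<^sup>2)\<close>, which is negative for small \<open>t > 0\<close> unless \<open>B x = 0\<close>.\<close>

lemma nonneg_form_zero_imp_kernel:
  fixes B :: "real ^ 'n ^ 'n"
  assumes sym: "transpose B = B"
    and nonneg: "\<And>y. (B *v y) \<bullet> y \<ge> 0"
    and zero: "(B *v x) \<bullet> x = 0"
  shows "B *v x = 0"
proof (rule ccontr)
  assume nz: "B *v x \<noteq> 0"
  define y where "y = B *v x"
  define a where "a = y \<bullet> y"
  define c where "c = (B *v y) \<bullet> y"
  define t where "t = a / (c + 1)"
  have a: "a > 0" and c: "c \<ge> 0"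
    using nz nonneg by (simp_all add: a_def c_def y_def)
  then have t: "t > 0" and tc: "t * c < 2 * a"
    by (auto simp: t_def field_simps intro: add_nonneg_pos)
  have "(B *v (x - t *\<^sub>R y)) \<bullet> (x - t *\<^sub>R y)
        = (B *v x) \<bullet> x - t * ((B *v x) \<bullet> y) - t * ((B *v y) \<bullet> x) + t * t * ((B *v y) \<bullet> y)"
    by (simp add: matrix_vector_mult_diff_distrib matrix_vector_mult_scaleR inner_diff_left
        inner_diff_right algebra_simps)
  also have "\<dots> = t * (t * c - 2 * a)"
    unfolding zero inner_matrix_symmetric[OF sym, of y x]
    by (simp add: a_def algebra_simps flip: y_def c_def)
  also have "\<dots> < 0"
    using t tc by (simp add: mult_less_0_iff)
  finally show False
    using nonneg[of "x - t *\<^sub>R y"] by simp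
qed

text \<open>The Rayleigh quotient \<open>\<langle>Ax, x\<rangle> / \<langle>Mx, x\<rangle>\<close> attains a maximum \<open>\<mu>\<close> on the unit sphere. The
  form of \<open>\<mu> M - A\<close> is then nonnegative and vanishes at the maximizer, which is therefore an
  eigenvector for \<open>\<mu>\<close>; and every eigenvalue is a value of the quotient. So \<open>\<mu>\<close> is the greatest
  eigenvalue.\<close>

lemma Rayleigh_bound:
  fixes A :: "real ^ 'n ^ 'n"
  assumes m: "\<And>k. m $ k > 0" and sym: "transpose A = A"
  shows "(A *v x) \<bullet> x \<le> max_gen_eigenvalue A (diag_matrix m) * ((diag_matrix m *v x) \<bullet> x)"
proof -
  let ?M = "diag_matrix m"
  let ?R = "\<lambda>x. (A *v x) \<bullet> x / ((?M *v x) \<bullet> x)"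
  note M_pos = inner_diag_matrix_pos[OF m]
  have nz: "x \<noteq> 0" if "x \<in> sphere 0 1" for x :: "real ^ 'n"
    using that by auto
  have cont: "continuous_on (sphere 0 1) ?R"
    using M_pos nz by (intro continuous_intros linear_continuous_on matrix_vector_mul_bounded_linear) force
  have "\<exists>x0 \<in> sphere 0 1. \<forall>y \<in> sphere 0 1. ?R y \<le> ?R x0"
    by (rule continuous_attains_sup[OF _ _ cont]) auto
  then obtain x0 where x0: "x0 \<in> sphere 0 1" and max: "\<And>y. y \<in> sphere 0 1 \<Longrightarrow> ?R y \<le> ?R x0"
    by blast
  define \<mu> where "\<mu> = ?R x0"
  have bound: "(A *v y) \<bullet> y \<le> \<mu> * ((?M *v y) \<bullet> y)" for y
  proof (cases "y = 0")
    case False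
    have "?R y = ?R (y /\<^sub>R norm y)"
      using False by (simp add: matrix_vector_mult_scaleR)
    also have "\<dots> \<le> \<mu>"
      unfolding \<mu>_def by (rule max) (use False in simp)
    finally show ?thesis
      using M_pos[OF False] by (simp add: pos_divide_le_eq)
  qed simp
  define B where "B = \<mu> *\<^sub>R ?M - A"
  have B: "B *v y = \<mu> *\<^sub>R (?M *v y) - A *v y" for y
    by (simp add: B_def matrix_vector_mult_diff_rdistrib scaleR_matrix_vector_assoc)
  have "B *v x0 = 0"
  proof (rule nonneg_form_zero_imp_kernel)
    have "transpose ?M = ?M"
      by (auto simp: transpose_def diag_matrix_def vec_eq_iff)
    then show "transpose B = B"
      using sym by (simp add: B_def transpose_def vec_eq_iff)
    show "(B *v y) \<bullet> y \<ge> 0" for y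
      using bound[of y] by (simp add: B inner_diff_left)
    show "(B *v x0) \<bullet> x0 = 0"
      using M_pos[OF nz[OF x0]] by (simp add: B inner_diff_left \<mu>_def)
  qed
  then have "gen_eigenvalue A ?M \<mu>"
    unfolding gen_eigenvalue_def using nz[OF x0] by (auto simp: B)
  moreover have "\<nu> \<le> \<mu>" if ev: "gen_eigenvalue A ?M \<nu>" for \<nu>
  proof -
    obtain \<phi> where \<phi>: "\<phi> \<noteq> 0" "A *v \<phi> = \<nu> *\<^sub>R (?M *v \<phi>)"
      using ev unfolding gen_eigenvalue_def by blast
    then show ?thesis
      using bound[of \<phi>] M_pos[OF \<phi>(1)] by simp
  qed
  ultimately have "max_gen_eigenvalue A ?M = \<mu>"
    unfolding max_gen_eigenvalue_def by (rule Greatest_equality)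
  with bound show ?thesis
    by simp
qed

lemma max_gen_eigenvalue_pos:
  fixes A :: "real ^ 'n ^ 'n"
  assumes m: "\<And>k. m $ k > 0" and sym: "transpose A = A" and "A $ i $ i > 0"
  shows "max_gen_eigenvalue A (diag_matrix m) > 0"
proof -
  let ?e = "axis i 1 :: real ^ 'n"
  have "0 < (A *v ?e) \<bullet> ?e"
    using assms(3) by (simp add: inner_axis matrix_vector_mul_component)
  also have "\<dots> \<le> max_gen_eigenvalue A (diag_matrix m) * ((diag_matrix m *v ?e) \<bullet> ?e)"
    by (rule Rayleigh_bound[OF m sym])
  finally show ?thesis
    using inner_diag_matrix_nonneg[OF m, of ?e] by (simp add: zero_less_mult_iff)
qed

section \<open>The energy does not increase\<close>

lemma powr_Suc_tangent:
  fixes a b p :: real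
  assumes "p > 0" "a > 0" "b > 0"
  shows "(p + 1) * a powr p * (b - a) \<le> b powr (p + 1) - a powr (p + 1)"
proof -
  have deriv: "((\<lambda>x. x powr (p + 1)) has_real_derivative (p + 1) * x powr p) (at x)"
    if "x > 0" for x
    using that by (auto intro!: derivative_eq_intros)
  have "convex_on {0<..} (\<lambda>x::real. x powr (p + 1))"
  proof (rule f''_ge0_imp_convex)
    show "((\<lambda>x. (p + 1) * x powr p) has_real_derivative (p + 1) * (p * x powr (p - 1))) (at x)"
      if "x \<in> {0<..}" for x
      using that by (auto intro!: derivative_eq_intros)
  qed (use assms deriv in auto)
  from convex_on_imp_above_tangent[OF this, where c = a and f' = "(p + 1) * a powr p" and x = b]
  show ?thesis
    using assms has_field_derivative_at_within[OF deriv[of a]] by (simp add: interior_open)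
qed

lemma inner_diag_matrix_vec_powr:
  assumes "\<And>k. u $ k > 0"
  shows "(diag_matrix m *v vec_powr u p) \<bullet> u = (\<Sum>k\<in>UNIV. m $ k * u $ k powr (p + 1))"
  using assms
  by (simp add: inner_diag_matrix vec_powr_def powr_add abs_of_pos mult.assoc)

lemma discrete_energy_alt:
  "discrete_energy A m p u
     = (A *v u) \<bullet> u / 2 - (\<Sum>k\<in>UNIV. m $ k * u $ k powr (p + 1)) / (p + 1)"
  by (simp add: discrete_energy_def inner_diag_matrix vec_powr_def)

lemma energy_nonincreasing:
  fixes A :: "real ^ 'n ^ 'n"
  assumes m: "\<And>k. m $ k > 0" and sym: "transpose A = A" and p: "p > 0"
    and u: "\<And>k. u $ k > 0" and v: "\<And>k. v $ k > 0"
    and \<tau>: "\<tau> > 0" "\<tau> * max_gen_eigenvalue A (diag_matrix m) \<le> 2"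
    and step: "diag_matrix m *v v
                 = diag_matrix m *v u + \<tau> *\<^sub>R (- (A *v u) + diag_matrix m *v vec_powr u p)"
  shows "discrete_energy A m p v \<le> discrete_energy A m p u"
proof -
  let ?M = "diag_matrix m" and ?\<eta> = "max_gen_eigenvalue A (diag_matrix m)"
  let ?P = "\<lambda>u. \<Sum>k\<in>UNIV. m $ k * u $ k powr (p + 1)"
  define Q where "Q u = ?P u / (p + 1)" for u :: "real ^ 'n"
  define d where "d = v - u"
  have v_eq: "v = u + d"
    by (simp add: d_def)
  have Md: "?M *v d = \<tau> *\<^sub>R (?M *v vec_powr u p - A *v u)"
    using step by (simp add: d_def matrix_vector_mult_diff_distrib)
  have form: "(A *v v) \<bullet> v = (A *v u) \<bullet> u + 2 * ((A *v u) \<bullet> d) + (A *v d) \<bullet> d"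
    unfolding v_eq using inner_matrix_symmetric[OF sym, of u d]
    by (simp add: matrix_vector_right_distrib inner_add_left inner_add_right)
  have "(p + 1) * ((?M *v vec_powr u p) \<bullet> d)
        = (\<Sum>k\<in>UNIV. m $ k * ((p + 1) * u $ k powr p * (v $ k - u $ k)))"
    by (simp add: inner_diag_matrix vec_powr_def sum_distrib_left d_def mult_ac)
  also have "\<dots> \<le> (\<Sum>k\<in>UNIV. m $ k * (v $ k powr (p + 1) - u $ k powr (p + 1)))"
    using powr_Suc_tangent[OF p u v] m by (intro sum_mono mult_left_mono less_imp_le[OF m])
  also have "\<dots> = ?P v - ?P u"
    by (simp add: right_diff_distrib sum_subtractf)
  finally have conv: "(?M *v vec_powr u p) \<bullet> d \<le> Q v - Q u"
    using p by (simp add: Q_def pos_le_divide_eq mult.commute flip: diff_divide_distrib)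
  have Md': "(?M *v d) \<bullet> d = \<tau> * ((?M *v vec_powr u p) \<bullet> d - (A *v u) \<bullet> d)"
    unfolding Md by (simp add: inner_diff_left)
  have "\<tau> * ((A *v d) \<bullet> d) \<le> \<tau> * (?\<eta> * ((?M *v d) \<bullet> d))"
    using \<tau>(1) by (intro mult_left_mono Rayleigh_bound[OF m sym]) simp
  also have "\<dots> \<le> 2 * ((?M *v d) \<bullet> d)"
    using mult_right_mono[OF \<tau>(2) inner_diag_matrix_nonneg[OF m, of d]] by (simp add: mult.assoc)
  also have "\<dots> = \<tau> * (2 * ((?M *v vec_powr u p) \<bullet> d - (A *v u) \<bullet> d))"
    by (simp add: Md')
  finally have "(A *v d) \<bullet> d \<le> 2 * ((?M *v vec_powr u p) \<bullet> d - (A *v u) \<bullet> d)"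
    using \<tau>(1) by simp
  then have "(A *v v) \<bullet> v / 2 \<le> (A *v u) \<bullet> u / 2 + (?M *v vec_powr u p) \<bullet> d"
    unfolding form by (simp add: field_simps)
  then have "(A *v v) \<bullet> v / 2 - Q v \<le> (A *v u) \<bullet> u / 2 - Q u"
    using conv by linarith
  then show ?thesis
    by (simp add: discrete_energy_alt Q_def)
qed

section \<open>Negative energy forces linear growth\<close>

text \<open>Both sides are compared with the maximum \<open>S\<close> of the entries: \<open>w \<le> (\<Sum>m) S\<close> and
  \<open>\<parallel>u\<parallel>\<^sub>M \<le> (\<Sum>m)\<^sup>1\<^sup>/\<^sup>2 S\<close>, whereas the entry that attains \<open>S\<close> alone contributes at least
  \<open>(min m) S\<^sup>p\<^sup>+\<^sup>1\<close> to the sum on the right.\<close>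

lemma mass_powr_mass_norm_le:
  fixes m u :: "real ^ 'n"
  assumes m: "\<And>k. m $ k > 0" and u: "\<And>k. u $ k > 0" and p: "p > 0"
  shows "(MIN k. m $ k) * (mass m u powr p * mass_norm m u)
           \<le> (\<Sum>k\<in>UNIV. m $ k) powr p * sqrt (\<Sum>k\<in>UNIV. m $ k)
              * (\<Sum>k\<in>UNIV. m $ k * u $ k powr (p + 1))"
proof -
  let ?T = "\<Sum>k\<in>UNIV. m $ k"
  define S where "S = (MAX k. u $ k)"
  have uS: "u $ k \<le> S" for k
    by (simp add: S_def)
  have "S \<in> range (\<lambda>k. u $ k)"
    unfolding S_def by (rule Max_in) auto
  then obtain i where i: "S = u $ i"
    by blast
  have S: "S > 0"
    using u by (simp add: i)
  have T: "?T > 0"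
    using m by (simp add: sum_pos)
  have "mass m u \<le> (\<Sum>k\<in>UNIV. m $ k * S)"
    unfolding mass_def by (intro sum_mono mult_left_mono uS less_imp_le[OF m])
  then have "mass m u \<le> ?T * S"
    by (simp add: sum_distrib_right)
  moreover have "mass m u \<ge> 0"
    unfolding mass_def by (intro sum_nonneg mult_nonneg_nonneg less_imp_le[OF m] less_imp_le[OF u])
  ultimately have w: "mass m u powr p \<le> ?T powr p * S powr p"
    using p S T powr_mono2[of p "mass m u" "?T * S"] by (simp add: powr_mult)
  have "(mass_norm m u)\<^sup>2 \<le> (\<Sum>k\<in>UNIV. m $ k * S\<^sup>2)"
    unfolding mass_norm_square[OF m]
    by (intro sum_mono mult_left_mono power_mono uS less_imp_le[OF m] less_imp_le[OF u])
  also have "\<dots> = (sqrt ?T * S)\<^sup>2"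
    using T by (simp add: sum_distrib_right power_mult_distrib)
  finally have n: "mass_norm m u \<le> sqrt ?T * S"
    by (rule power2_le_imp_le) (use S T in simp)
  have min: "(MIN k. m $ k) \<le> m $ i" "(MIN k. m $ k) > 0"
    using m by simp_all
  have "(MIN k. m $ k) * (mass m u powr p * mass_norm m u)
        \<le> m $ i * ((?T powr p * S powr p) * (sqrt ?T * S))"
    using w n min S T less_imp_le[OF m, of i] by (intro mult_mono) (auto simp: mass_norm_def)
  also have "\<dots> = ?T powr p * sqrt ?T * (m $ i * u $ i powr (p + 1))"
    using S by (simp add: powr_add i)
  also have "\<dots> \<le> ?T powr p * sqrt ?T * (\<Sum>k\<in>UNIV. m $ k * u $ k powr (p + 1))"
    using T by (intro mult_left_mono member_le_sum mult_nonneg_nonneg less_imp_le[OF m]) auto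
  finally show ?thesis .
qed

text \<open>All entries being positive, no single term \<open>m\<^sub>k u\<^sub>k\<close> exceeds the mass \<open>w\<close>. Replacing one
  factor \<open>u\<^sub>k\<close> of each term of \<open>\<parallel>u\<parallel>\<^sub>M\<^sup>2 = \<Sum>m\<^sub>k u\<^sub>k u\<^sub>k\<close> by \<open>w / min m\<close> leaves \<open>w\<^sup>2 / min m\<close>.\<close>

lemma mass_norm_le_mass:
  fixes m u :: "real ^ 'n"
  assumes m: "\<And>k. m $ k > 0" and u: "\<And>k. u $ k > 0"
  shows "sqrt (MIN k. m $ k) * mass_norm m u \<le> mass m u"
proof -
  let ?\<mu> = "MIN k. m $ k"
  have pos: "?\<mu> > 0"
    using m by simp
  have w: "mass m u \<ge> 0"
    unfolding mass_def by (intro sum_nonneg mult_nonneg_nonneg less_imp_le[OF m] less_imp_le[OF u])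
  have term_le: "?\<mu> * u $ k \<le> mass m u" for k
  proof -
    have "?\<mu> * u $ k \<le> m $ k * u $ k"
      by (intro mult_right_mono less_imp_le[OF u]) simp
    also have "\<dots> \<le> mass m u"
      unfolding mass_def
      by (intro member_le_sum mult_nonneg_nonneg less_imp_le[OF m] less_imp_le[OF u]) auto
    finally show ?thesis .
  qed
  have "(sqrt ?\<mu> * mass_norm m u)\<^sup>2 = (\<Sum>k\<in>UNIV. m $ k * u $ k * (?\<mu> * u $ k))"
    unfolding power_mult_distrib real_sqrt_pow2[OF less_imp_le[OF pos]] mass_norm_square[OF m]
      sum_distrib_left
    by (simp add: power2_eq_square mult_ac)
  also have "\<dots> \<le> (\<Sum>k\<in>UNIV. m $ k * u $ k * mass m u)"
    by (intro sum_mono mult_left_mono term_le mult_nonneg_nonneg less_imp_le[OF m] less_imp_le[OF u])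
  also have "\<dots> = (mass m u)\<^sup>2"
    unfolding mass_def by (simp add: sum_distrib_right power2_eq_square)
  finally show ?thesis
    by (rule power2_le_imp_le) (rule w)
qed

lemma mass_le_infnorm:
  fixes m u :: "real ^ 'n"
  assumes m: "\<And>k. m $ k > 0"
  shows "mass m u \<le> (\<Sum>k\<in>UNIV. m $ k) * infnorm u"
  unfolding mass_def sum_distrib_right
proof (intro sum_mono mult_left_mono less_imp_le[OF m])
  show "u $ k \<le> infnorm u" for k
    using component_le_infnorm_cart[of u k] by linarith
qed

text \<open>The increment is independent of \<open>u\<close> because \<open>\<tau> = \<lambda> / w\<^sup>p\<close> cancels the factor \<open>w\<^sup>p\<close> that
  the comparison of norms produces from the nonlinear term.\<close>

lemma mass_norm_step:
  fixes A :: "real ^ 'n ^ 'n"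
  assumes m: "\<And>k. m $ k > 0" and p: "p > 1" and lam: "lam > 0"
    and u: "\<And>k. u $ k > 0"
    and step: "diag_matrix m *v v
                 = diag_matrix m *v u
                   + (lam / mass m u powr p) *\<^sub>R (- (A *v u) + diag_matrix m *v vec_powr u p)"
    and neg: "discrete_energy A m p u \<le> 0"
  shows "mass_norm m u + lam * ((p - 1) / (p + 1))
             * ((MIN k. m $ k) / ((\<Sum>k\<in>UNIV. m $ k) powr p * sqrt (\<Sum>k\<in>UNIV. m $ k)))
           \<le> mass_norm m v"
proof -
  let ?M = "diag_matrix m" and ?T = "\<Sum>k\<in>UNIV. m $ k"
  let ?P = "\<Sum>k\<in>UNIV. m $ k * u $ k powr (p + 1)"
  let ?n = "mass_norm m"
  let ?c = "(MIN k. m $ k) / (?T powr p * sqrt ?T)"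
  define \<tau> where "\<tau> = lam / mass m u powr p"
  have w: "mass m u > 0"
    unfolding mass_def using m u by (intro sum_pos) auto
  have \<tau>: "\<tau> > 0"
    using lam w by (simp add: \<tau>_def)
  have lam_eq: "lam = \<tau> * mass m u powr p"
    using w by (simp add: \<tau>_def)
  have T: "?T > 0"
    using m by (simp add: sum_pos)
  have "u \<noteq> 0"
    using u by (metis less_irrefl zero_index)
  then have n: "?n u > 0"
    using inner_diag_matrix_pos[OF m, of u] mass_norm_Cauchy_Schwarz[OF m, of u u]
    by (auto simp: mass_norm_def simp flip: power2_eq_square intro: ccontr)
  have "(A *v u) \<bullet> u / 2 \<le> ?P / (p + 1)"
    using neg by (simp add: discrete_energy_alt)
  then have gain: "(p - 1) / (p + 1) * ?P \<le> ?P - (A *v u) \<bullet> u"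
    using p by (simp add: field_simps)
  have "?c * (mass m u powr p * ?n u) \<le> ?P"
    using mass_powr_mass_norm_le[OF m u, of p] p T by (simp add: field_simps)
  then have "\<tau> * ((p - 1) / (p + 1)) * (?c * (mass m u powr p * ?n u))
             \<le> \<tau> * ((p - 1) / (p + 1)) * ?P"
    using \<tau> p by (intro mult_left_mono) auto
  also have "\<dots> \<le> \<tau> * (?P - (A *v u) \<bullet> u)"
    using mult_left_mono[OF gain, of \<tau>] \<tau> by (simp add: mult.assoc)
  finally have key: "lam * ((p - 1) / (p + 1)) * ?c * ?n u \<le> \<tau> * (?P - (A *v u) \<bullet> u)"
    unfolding lam_eq by (simp only: mult_ac)
  have "(?M *v v) \<bullet> u = (?n u)\<^sup>2 + \<tau> * (?P - (A *v u) \<bullet> u)"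
    unfolding step mass_norm_square[OF m] \<tau>_def
    by (simp add: inner_add_left inner_diff_left inner_diag_matrix_vec_powr[OF u] inner_diag_matrix[of m u u]
        power2_eq_square mult.assoc)
  with key mass_norm_Cauchy_Schwarz[OF m, of v u]
  have "(?n u + lam * ((p - 1) / (p + 1)) * ?c) * ?n u \<le> ?n v * ?n u"
    by (simp add: power2_eq_square distrib_right)
  then show ?thesis
    using n by (simp only: mult_le_cancel_right_pos)
qed

section \<open>Blow-up\<close>

theorem theorem2p1:
  fixes A :: "real ^ 'n ^ 'n" and m :: "real ^ 'n" and p lam :: real
    and U :: "nat \<Rightarrow> real ^ 'n"
  assumes "p > 1"
    and "\<And>k. m $ k > 0"
    and "transpose A = A"
    and "pos_semidefinite A"
    and "\<And>i k. i \<noteq> k \<Longrightarrow> A $ i $ k \<le> 0"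
    and "\<And>i. A $ i $ i > 0"
    and "\<And>i. (\<Sum>k\<in>UNIV. A $ i $ k) \<ge> 0"
    and "lam > 0"
    and "explicit_scheme A m p lam U"
    and "lam < (MIN i. m $ i / A $ i $ i) * (mass m (U 0)) powr p"
    and "\<And>j i. U j $ i > 0"
    and "\<And>j. time_step m p lam U j
               < 2 / (p * (mass m (U (Suc j))) powr (p - 1)
                      + max_gen_eigenvalue A (diag_matrix m))"
    and "\<exists>j\<^sub>0. discrete_energy A m p (U j\<^sub>0) < 0"
  shows "blows_up (time_step m p lam U) U"
proof -
  note p = assms(1) and m = assms(2) and sym = assms(3) and lam = assms(8) and pos = assms(11)
  let ?\<eta> = "max_gen_eigenvalue A (diag_matrix m)" and ?\<tau> = "time_step m p lam U"
  let ?T = "\<Sum>k\<in>UNIV. m $ k" and ?\<Phi> = "discrete_energy A m p"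
  have step: "diag_matrix m *v U (Suc j)
      = diag_matrix m *v U j + ?\<tau> j *\<^sub>R (- (A *v U j) + diag_matrix m *v vec_powr (U j) p)" for j
    using assms(9) by (simp add: explicit_scheme_def)
  have w_pos: "mass m (U j) > 0" for j
    unfolding mass_def using m pos by (intro sum_pos) auto
  have \<eta>: "?\<eta> > 0"
    using max_gen_eigenvalue_pos[OF m sym assms(6)] .
  have decr: "?\<Phi> (U (Suc j)) \<le> ?\<Phi> (U j)" for j
  proof (rule energy_nonincreasing[OF m sym _ pos pos _ _ step])
    show "?\<tau> j > 0"
      using lam w_pos[of j] by (simp add: time_step_def)
    have "?\<tau> j < 2 / (p * mass m (U (Suc j)) powr (p - 1) + ?\<eta>)"
      using assms(12) .
    also have "\<dots> \<le> 2 / ?\<eta>"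
      using \<eta> p by (intro divide_left_mono) (auto intro!: mult_pos_pos add_nonneg_pos)
    finally show "?\<tau> j * ?\<eta> \<le> 2"
      using \<eta> by (simp add: pos_less_divide_eq)
  qed (use p in simp)
  obtain j0 where j0: "?\<Phi> (U j0) < 0"
    using assms(13) by blast
  have neg: "?\<Phi> (U (j0 + n)) \<le> 0" for n
    using lift_Suc_antimono_le[of "\<lambda>j. ?\<Phi> (U j)" j0 "j0 + n"] decr j0 by force
  define K where "K = lam * ((p - 1) / (p + 1)) * ((MIN k. m $ k) / (?T powr p * sqrt ?T))"
  have T: "?T > 0"
    using m by (simp add: sum_pos)
  have min_pos: "(MIN k. m $ k) > 0"
    using m by simp
  have K: "K > 0"
    using lam p T min_pos by (simp add: K_def)
  have norm_growth: "K * real n \<le> mass_norm m (U (j0 + n))" for n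
  proof (induction n)
    case 0
    show ?case
      by (simp add: mass_norm_def)
  next
    case (Suc n)
    have "mass_norm m (U (j0 + n)) + K \<le> mass_norm m (U (Suc (j0 + n)))"
      unfolding K_def using mass_norm_step[OF m p lam pos step[unfolded time_step_def] neg] .
    with Suc show ?case
      by (simp add: distrib_left)
  qed
  define c where "c = sqrt (MIN k. m $ k) * K"
  have c: "c > 0"
    using K min_pos by (simp add: c_def)
  have mass_growth: "c * real n \<le> mass m (U (j0 + n))" for n
  proof -
    have "c * real n \<le> sqrt (MIN k. m $ k) * mass_norm m (U (j0 + n))"
      unfolding c_def mult.assoc
      by (intro mult_left_mono norm_growth real_sqrt_ge_zero less_imp_le[OF min_pos])
    also have "\<dots> \<le> mass m (U (j0 + n))"
      by (rule mass_norm_le_mass[OF m pos])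
    finally show ?thesis .
  qed
  have "filterlim (\<lambda>n. infnorm (U (n + j0))) at_top sequentially"
  proof (rule filterlim_at_top_mono)
    show "filterlim (\<lambda>n. c / ?T * real n) at_top sequentially"
      using c T by (intro filterlim_tendsto_pos_mult_at_top[OF tendsto_const] filterlim_real_sequentially) simp
    have "c / ?T * real n \<le> infnorm (U (n + j0))" for n
      using mass_growth[of n] mass_le_infnorm[OF m, of "U (j0 + n)"] T
      by (simp add: field_simps)
    then show "\<forall>\<^sub>F n in sequentially. c / ?T * real n \<le> infnorm (U (n + j0))"
      by simp
  qed
  then have "filterlim (\<lambda>j. infnorm (U j)) at_top sequentially"
    unfolding filterlim_iff eventually_sequentially_seg[of "\<lambda>j. P (infnorm (U j))" j0 for P] .
  moreover have "summable (\<lambda>n. ?\<tau> (n + j0))"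
  proof (rule summable_comparison_test')
    show "summable (\<lambda>n. lam / c powr p * real n powr - p)"
      using p by (intro summable_mult) (simp add: summable_real_powr_iff)
    show "norm (?\<tau> (n + j0)) \<le> lam / c powr p * real n powr - p" if "n \<ge> 1" for n
    proof -
      have "(c * real n) powr p \<le> mass m (U (j0 + n)) powr p"
        using mass_growth[of n] c p by (intro powr_mono2) auto
      then have "?\<tau> (n + j0) \<le> lam / (c * real n) powr p"
        unfolding time_step_def using lam c that
        by (intro divide_left_mono) (auto simp: add.commute intro!: mult_pos_pos)
      also have "\<dots> = lam / c powr p * real n powr - p"
        using c that by (simp add: powr_mult powr_minus field_simps)
      finally show ?thesis
        using lam w_pos[of "n + j0"] by (simp add: time_step_def)
    qed
  qed
  then have "summable ?\<tau>"
    by simp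
  ultimately show ?thesis
    by (simp add: blows_up_def)
qed

end
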